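(* Let $n\in\mathbb{N}$ and let $G$ be a connected, infinite, unbounded graph. If $G$ is coarsely $(n+1)$-bottlenecked but not coarsely $n$-bottlenecked, then $G$ contains $D_{n+1}$ as an asymptotic minor.
   Context: $\mathbb{N}$ is the set of positive integers. A graph consists of a vertex set $V(G)$ and an edge set $E(G)$, each edge being associated with two vertices (its endpoints); multiple edges are allowed. The standing assumption that graphs are connected, infinite and unbounded (infinite diameter) applies to the host graph $G$, not to its minors. $d$ is the graph distance, and $d(A,B)$ is the least distance between a vertex of $A$ and a vertex of $B$. Two sets or subgraphs are $M$-disjoint if their distance in $G$ is at least $M$. For $S\subseteq V(G)$, $N_M(S)=\{x\in V(G): d(x,S)<M\}$. An $X,Y$ path is a path with one endpoint in $X$ and the other in $Y$. $M$-fat $n$-bottlenecked: for any two connected, $M$-disjoint subgraphs $X,Y\subset G$ there is a set $S\subset V(G)\setminus(V(X)\cup V(Y))$ of size at most $n$ such that every $X,Y$ path intersects $N_M(S)$. Coarsely $n$-bottlenecked: $M$-fat $n$-bottlenecked for some $M\in\mathbb{N}$. $D_n$ is the dipole graph: two vertices joined by $n$ parallel edges. Minor: $G$ contains $H$ as a minor if there are pairwise disjoint connected subgraphs $B_v$ of $G$ ($v\in V(H)$) and paths $P_e$ ($e\in E(H)$), where for $e$ with endpoints $u,v$ the path $P_e$ joins $B_u$ to $B_v$ and is otherwise disjoint from all the $B_w$, and the interiors of the paths $P_e$ are pairwise disjoint (so that contracting each of these sets produces $H$). The minor is $M$-fat if all these sets $B_v,P_e$ are pairwise $M$-disjoint,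 except for pairs $B_v,P_e$ where $v$ is an endpoint of $e$ in $H$. $G$ contains $H$ as an asymptotic minor if $G$ contains an $M$-fat $H$ minor for every $M\in\mathbb{N}$. *)

theory Defs
  imports Main "HOL-Library.Extended_Nat"
begin

text \<open>Parallel edges and loops are allowed: \<open>ends G e\<close> is the set of endpoints of the edge \<open>e\<close>,
  a singleton if \<open>e\<close> is a loop.\<close>

record ('v, 'e) mgraph =
  verts :: "'v set"
  edges :: "'e set"
  ends :: "'e \<Rightarrow> 'v set"

definition multigraph :: "('v, 'e) mgraph \<Rightarrow> bool" where
  "multigraph G \<longleftrightarrow> (\<forall>e\<in>edges G. \<exists>u\<in>verts G. \<exists>v\<in>verts G. ends G e = {u, v})"

definition subgraph :: "('v, 'e) mgraph \<Rightarrow> ('v, 'e) mgraph \<Rightarrow> bool" where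
  "subgraph X G \<longleftrightarrow> multigraph X \<and> verts X \<subseteq> verts G \<and> edges X \<subseteq> edges G
     \<and> (\<forall>e\<in>edges X. ends X e = ends G e)"

text \<open>A path is given by its list of vertices and its list of edges. The edges are recorded since
  parallel edges give different paths with the same vertices. A single vertex is a path.\<close>

type_synonym ('v, 'e) gpath = "'v list \<times> 'e list"

definition is_path :: "('v, 'e) mgraph \<Rightarrow> ('v, 'e) gpath \<Rightarrow> bool" where
  "is_path G p \<longleftrightarrow> (case p of (xs, es) \<Rightarrow>
     length xs = Suc (length es) \<and> distinct xs \<and> set xs \<subseteq> verts G \<and> set es \<subseteq> edges G
     \<and> (\<forall>i < length es. ends G (es ! i) = {xs ! i, xs ! Suc i}))"

definition path_verts :: "('v, 'e) gpath \<Rightarrow> 'v set" where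
  "path_verts p = set (fst p)"

definition path_edges :: "('v, 'e) gpath \<Rightarrow> 'e set" where
  "path_edges p = set (snd p)"

definition path_len :: "('v, 'e) gpath \<Rightarrow> nat" where
  "path_len p = length (snd p)"

definition path_start :: "('v, 'e) gpath \<Rightarrow> 'v" where
  "path_start p = hd (fst p)"

definition path_end :: "('v, 'e) gpath \<Rightarrow> 'v" where
  "path_end p = last (fst p)"

definition inner_verts :: "('v, 'e) gpath \<Rightarrow> 'v set" where
  "inner_verts p = path_verts p - {path_start p, path_end p}"

definition path_between :: "('v, 'e) mgraph \<Rightarrow> 'v set \<Rightarrow> 'v set \<Rightarrow> ('v, 'e) gpath \<Rightarrow> bool" where
  "path_between G A B p \<longleftrightarrow> is_path G p \<and> path_start p \<in> A \<and> path_end p \<in> B"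

definition connected_graph :: "('v, 'e) mgraph \<Rightarrow> bool" where
  "connected_graph G \<longleftrightarrow> verts G \<noteq> {}
     \<and> (\<forall>x\<in>verts G. \<forall>y\<in>verts G. \<exists>p. path_between G {x} {y} p)"

text \<open>Distances are extended naturals; the distance to the empty set is \<open>\<infinity>\<close>.\<close>

definition gdist :: "('v, 'e) mgraph \<Rightarrow> 'v \<Rightarrow> 'v \<Rightarrow> enat" where
  "gdist G x y = Inf {enat (path_len p) | p. path_between G {x} {y} p}"

definition set_dist :: "('v, 'e) mgraph \<Rightarrow> 'v set \<Rightarrow> 'v set \<Rightarrow> enat" where
  "set_dist G A B = (INF x\<in>A. INF y\<in>B. gdist G x y)"

definition diameter :: "('v, 'e) mgraph \<Rightarrow> enat" where
  "diameter G = (SUP x\<in>verts G. SUP y\<in>verts G. gdist G x y)"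

definition unbounded_graph :: "('v, 'e) mgraph \<Rightarrow> bool" where
  "unbounded_graph G \<longleftrightarrow> diameter G = \<infinity>"

definition far_disjoint :: "('v, 'e) mgraph \<Rightarrow> nat \<Rightarrow> 'v set \<Rightarrow> 'v set \<Rightarrow> bool" where
  "far_disjoint G M A B \<longleftrightarrow> enat M \<le> set_dist G A B"

definition nbhd :: "('v, 'e) mgraph \<Rightarrow> nat \<Rightarrow> 'v set \<Rightarrow> 'v set" where
  "nbhd G M S = {x \<in> verts G. set_dist G {x} S < enat M}"

definition fat_bottlenecked :: "('v, 'e) mgraph \<Rightarrow> nat \<Rightarrow> nat \<Rightarrow> bool" where
  "fat_bottlenecked G M n \<longleftrightarrow>
     (\<forall>X Y. subgraph X G \<and> connected_graph X \<and> subgraph Y G \<and> connected_graph Y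
        \<and> far_disjoint G M (verts X) (verts Y) \<longrightarrow>
        (\<exists>S. S \<subseteq> verts G - (verts X \<union> verts Y) \<and> finite S \<and> card S \<le> n
           \<and> (\<forall>p. path_between G (verts X) (verts Y) p \<longrightarrow> path_verts p \<inter> nbhd G M S \<noteq> {})))"

definition coarsely_bottlenecked :: "('v, 'e) mgraph \<Rightarrow> nat \<Rightarrow> bool" where
  "coarsely_bottlenecked G n \<longleftrightarrow> (\<exists>M\<ge>1. fat_bottlenecked G M n)"

definition dipole :: "nat \<Rightarrow> (bool, nat) mgraph" where
  "dipole n = \<lparr>verts = {False, True}, edges = {..<n}, ends = (\<lambda>_. {False, True})\<rparr>"

text \<open>\<open>B\<close> gives the branch sets and \<open>P\<close> the paths. Disjointness is meant for subgraphs, hence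
  includes edges: two paths consisting of one edge each must not use the same edge. The condition
  \<open>path_len (P e) \<ge> 1\<close> only matters if \<open>e\<close> is a loop; otherwise it follows from the
  disjointness of the branch sets.\<close>

definition minor_model ::
  "('v, 'e) mgraph \<Rightarrow> ('w, 'f) mgraph \<Rightarrow> ('w \<Rightarrow> ('v, 'e) mgraph) \<Rightarrow> ('f \<Rightarrow> ('v, 'e) gpath) \<Rightarrow> bool" where
  "minor_model G H B P \<longleftrightarrow>
     (\<forall>v\<in>verts H. subgraph (B v) G \<and> connected_graph (B v))
   \<and> (\<forall>v\<in>verts H. \<forall>w\<in>verts H. v \<noteq> w \<longrightarrow> verts (B v) \<inter> verts (B w) = {})
   \<and> (\<forall>e\<in>edges H. path_len (P e) \<ge> 1 \<and>
        (\<exists>u v. ends H e = {u, v} \<and> path_between G (verts (B u)) (verts (B v)) (P e)))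
   \<and> (\<forall>e\<in>edges H. \<forall>w\<in>verts H. inner_verts (P e) \<inter> verts (B w) = {}
        \<and> path_edges (P e) \<inter> edges (B w) = {})
   \<and> (\<forall>e\<in>edges H. \<forall>f\<in>edges H. e \<noteq> f \<longrightarrow> inner_verts (P e) \<inter> inner_verts (P f) = {}
        \<and> path_edges (P e) \<inter> path_edges (P f) = {})"

definition fat_minor_model ::
  "('v, 'e) mgraph \<Rightarrow> nat \<Rightarrow> ('w, 'f) mgraph \<Rightarrow> ('w \<Rightarrow> ('v, 'e) mgraph) \<Rightarrow> ('f \<Rightarrow> ('v, 'e) gpath) \<Rightarrow> bool" where
  "fat_minor_model G M H B P \<longleftrightarrow> minor_model G H B P
   \<and> (\<forall>v\<in>verts H. \<forall>w\<in>verts H. v \<noteq> w \<longrightarrow> far_disjoint G M (verts (B v)) (verts (B w)))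
   \<and> (\<forall>e\<in>edges H. \<forall>f\<in>edges H. e \<noteq> f \<longrightarrow> far_disjoint G M (path_verts (P e)) (path_verts (P f)))
   \<and> (\<forall>v\<in>verts H. \<forall>e\<in>edges H. v \<notin> ends H e \<longrightarrow>
        far_disjoint G M (verts (B v)) (path_verts (P e)))"

definition asymptotic_minor :: "('v, 'e) mgraph \<Rightarrow> ('w, 'f) mgraph \<Rightarrow> bool" where
  "asymptotic_minor G H \<longleftrightarrow> (\<forall>M\<ge>1. \<exists>B P. fat_minor_model G M H B P)"

end

theory Submission
  imports Defs
begin

text \<open>Fix \<open>K\<close>, let \<open>G\<close> be \<open>M\<^sub>0\<close>-fat \<open>(n+1)\<close>-bottlenecked, and take \<open>X\<close>, \<open>Y\<close> witnessing that \<open>G\<close> is not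
  \<open>M\<close>-fat \<open>n\<close>-bottlenecked for a large \<open>M\<close>. Let \<open>S\<close> consist of at most \<open>n + 1\<close> points whose
  \<open>M\<^sub>0\<close>-balls meet all \<open>X\<close>, \<open>Y\<close> paths. If two points of \<open>S\<close> were close, then one of
  them could be dropped at the price of enlarging the balls to radius \<open>M\<close>, so \<open>S\<close> has exactly \<open>n + 1\<close>
  points and they are far apart. Similarly, for each \<open>s \<in> S\<close> some \<open>X\<close>, \<open>Y\<close> path stays far away from
  \<open>S - {s}\<close> and hence passes near \<open>s\<close>. Enlarge \<open>X\<close> and \<open>Y\<close> by everything they reach outside of the
  \<open>(K + M\<^sub>0)\<close>-balls around \<open>S\<close>. The enlarged sets are still at distance at least \<open>K\<close>, since a short
  connection between them would give an \<open>X\<close>, \<open>Y\<close> path missing the \<open>M\<^sub>0\<close>-balls, and both come close to each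
  \<open>s \<in> S\<close>. The paths of the dipole are found inside balls around the points of \<open>S\<close>.\<close>

section \<open>Links and paths\<close>

text \<open>Connectivity inside a vertex set is expressed by the reflexive transitive closure of
  this relation, so that joining walks is plain transitivity and paths are extracted only where they
  are required. The closure and the power 0 also relate points outside of \<open>W\<close> to
  themselves, hence side conditions such as \<open>x \<in> W\<close> below.\<close>

definition lnk :: "('v, 'e) mgraph \<Rightarrow> 'v set \<Rightarrow> 'v rel" where
  "lnk G W = {(u, v). u \<in> W \<and> v \<in> W \<and> (\<exists>e\<in>edges G. ends G e = {u, v})}"

lemma lnk_mono: "V \<subseteq> W \<Longrightarrow> lnk G V \<subseteq> lnk G W"
  by (auto simp: lnk_def)

lemma lnk_rtrancl_mono: "(x, y) \<in> (lnk G V)\<^sup>* \<Longrightarrow> V \<subseteq> W \<Longrightarrow> (x, y) \<in> (lnk G W)\<^sup>*"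
  using rtrancl_mono[OF lnk_mono] by blast

lemma lnk_relpow_mono: "(x, y) \<in> lnk G V ^^ k \<Longrightarrow> V \<subseteq> W \<Longrightarrow> (x, y) \<in> lnk G W ^^ k"
proof (induction k arbitrary: y)
  case (Suc k)
  then show ?case using lnk_mono by fastforce
qed simp

lemma sym_lnk: "sym (lnk G W)"
  by (auto simp: lnk_def sym_def insert_commute)

lemma lnk_rtrancl_sym: "(x, y) \<in> (lnk G W)\<^sup>* \<Longrightarrow> (y, x) \<in> (lnk G W)\<^sup>*"
  using sym_rtrancl[OF sym_lnk] by (rule symD)

lemma lnk_relpow_sym: "(x, y) \<in> lnk G W ^^ k \<Longrightarrow> (y, x) \<in> lnk G W ^^ k"
proof (induction k arbitrary: y)
  case (Suc k)
  then obtain z where "(x, z) \<in> lnk G W ^^ k" "(z, y) \<in> lnk G W" by auto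
  with Suc.IH show ?case by (meson relpow_Suc_I2 sym_lnk symD)
qed simp

lemma lnk_rtrancl_mem: "(x, y) \<in> (lnk G W)\<^sup>* \<Longrightarrow> x \<in> W \<Longrightarrow> y \<in> W"
  by (induction rule: rtrancl_induct) (auto simp: lnk_def)

section \<open>Passing between walks and paths\<close>

lemma is_path_nonempty: "is_path G p \<Longrightarrow> fst p \<noteq> []"
  by (auto simp: is_path_def)

lemma is_path_take:
  assumes "is_path G (xs, es)" "i < length xs"
  shows "is_path G (take (Suc i) xs, take i es)"
  using assms by (auto simp: is_path_def dest: in_set_takeD)

lemma is_path_drop:
  assumes "is_path G (xs, es)" "i < length xs"
  shows "is_path G (drop i xs, drop i es)"
  using assms by (auto simp: is_path_def dest: in_set_dropD)

text \<open>The walk is turned into a path edge by edge: if the new end already lies on the path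
  built so far, the path is cut there, otherwise the edge is appended. The length stays at most
  \<open>k\<close> in both cases.\<close>

lemma path_of_relpow:
  assumes "(x, y) \<in> lnk G W ^^ k" "x \<in> W" "W \<subseteq> verts G"
  shows "\<exists>p. path_between G {x} {y} p \<and> path_verts p \<subseteq> W \<and> path_len p \<le> k"
  using assms(1)
proof (induction k arbitrary: y)
  case 0
  then show ?case using assms(2,3)
    by (intro exI[of _ "([x], [])"])
      (auto simp: path_between_def is_path_def path_start_def path_end_def path_verts_def path_len_def)
next
  case (Suc k)
  then obtain z where z: "(x, z) \<in> lnk G W ^^ k" "(z, y) \<in> lnk G W" by auto
  from Suc.IH[OF z(1)] obtain xs es where
    p: "is_path G (xs, es)" "hd xs = x" "last xs = z" "set xs \<subseteq> W" "length es \<le> k"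
    by (auto simp: path_between_def path_start_def path_end_def path_verts_def path_len_def)
  from z(2) obtain e where e: "y \<in> W" "e \<in> edges G" "ends G e = {z, y}" by (auto simp: lnk_def)
  have ne: "xs \<noteq> []" using is_path_nonempty[OF p(1)] by simp
  show ?case
  proof (cases "y \<in> set xs")
    case True
    then obtain i where i: "i < length xs" "xs ! i = y" by (auto simp: in_set_conv_nth)
    have "hd (take (Suc i) xs) = x" using p(2) ne by (cases xs) auto
    moreover have "last (take (Suc i) xs) = y" using i by (simp add: take_Suc_conv_app_nth)
    moreover have "set (take (Suc i) xs) \<subseteq> W" using p(4) by (auto dest: in_set_takeD)
    ultimately show ?thesis using is_path_take[OF p(1) i(1)] p(5)
      by (intro exI[of _ "(take (Suc i) xs, take i es)"])
        (auto simp: path_between_def path_start_def path_end_def path_verts_def path_len_def)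
  next
    case False
    have len: "length xs = Suc (length es)" using p(1) by (simp add: is_path_def)
    have zl: "xs ! length es = z" using p(3) ne len by (simp add: last_conv_nth)
    have "is_path G (xs @ [y], es @ [e])"
      using p(1) e False assms(3) len zl
      by (auto simp: is_path_def nth_append less_Suc_eq)
    then show ?thesis using p e ne
      by (intro exI[of _ "(xs @ [y], es @ [e])"])
        (auto simp: path_between_def path_start_def path_end_def path_verts_def path_len_def)
  qed
qed

lemma path_of_rtrancl:
  assumes "(x, y) \<in> (lnk G W)\<^sup>*" "x \<in> W" "W \<subseteq> verts G"
  shows "\<exists>p. path_between G {x} {y} p \<and> path_verts p \<subseteq> W"
  using assms path_of_relpow rtrancl_imp_relpow by metis

lemma relpow_of_path:
  assumes "is_path G (xs, es)" "i \<le> j" "j < length xs"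
  shows "(xs ! i, xs ! j) \<in> lnk G (set xs) ^^ (j - i)"
  using assms(2,3)
proof (induction j rule: dec_induct)
  case (step j)
  have "length xs = Suc (length es)" using assms(1) by (simp add: is_path_def)
  then have j: "j < length es" using step by simp
  then have "ends G (es ! j) = {xs ! j, xs ! Suc j}" "es ! j \<in> edges G"
    using assms(1) by (auto simp: is_path_def)
  then have "(xs ! j, xs ! Suc j) \<in> lnk G (set xs)" using step by (auto simp: lnk_def)
  with step have "(xs ! i, xs ! Suc j) \<in> lnk G (set xs) ^^ Suc (j - i)" by auto
  then show ?case using step by (simp add: Suc_diff_le)
qed simp

lemma path_verts_linked:
  assumes "is_path G p" "u \<in> path_verts p" "v \<in> path_verts p"
  shows "(u, v) \<in> (lnk G (path_verts p))\<^sup>*"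
proof -
  obtain xs es where p: "p = (xs, es)" by force
  with assms obtain i j where ij: "i < length xs" "xs ! i = u" "j < length xs" "xs ! j = v"
    by (auto simp: path_verts_def in_set_conv_nth)
  have *: "(xs ! i, xs ! j) \<in> (lnk G (set xs))\<^sup>*" if "i \<le> j" "j < length xs" for i j
    using relpow_of_path[of G xs es i j] assms that p by (auto intro: relpow_imp_rtrancl)
  show ?thesis
  proof (cases "i \<le> j")
    case True
    then show ?thesis using * ij p by (auto simp: path_verts_def)
  next
    case False
    then have "(v, u) \<in> (lnk G (path_verts p))\<^sup>*" using *[of j i] ij p by (auto simp: path_verts_def)
    then show ?thesis by (rule lnk_rtrancl_sym)
  qed
qed

lemma path_ends_mem:
  assumes "is_path G p"
  shows "path_start p \<in> path_verts p" "path_end p \<in> path_verts p"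
  using is_path_nonempty[OF assms] by (auto simp: path_start_def path_end_def path_verts_def)

lemma path_verts_subset: "is_path G p \<Longrightarrow> path_verts p \<subseteq> verts G"
  by (auto simp: is_path_def path_verts_def)

lemma path_edge_ends:
  assumes "is_path G p" "e \<in> path_edges p"
  shows "\<exists>u v. u \<noteq> v \<and> ends G e = {u, v} \<and> u \<in> path_verts p \<and> v \<in> path_verts p"
proof -
  obtain xs es where p: "p = (xs, es)" by force
  with assms obtain i where i: "i < length es" "es ! i = e"
    by (auto simp: path_edges_def in_set_conv_nth)
  have "ends G e = {xs ! i, xs ! Suc i}" "Suc i < length xs" "distinct xs"
    using assms i p by (auto simp: is_path_def)
  moreover from this have "xs ! i \<noteq> xs ! Suc i" by (simp add: nth_eq_iff_index_eq)
  ultimately show ?thesis using p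
    by (intro exI[of _ "xs ! i"] exI[of _ "xs ! Suc i"]) (auto simp: path_verts_def)
qed

text \<open>A shortest \<open>A\<close>, \<open>B\<close> path inside \<open>W\<close> will do: at
  an inner vertex in \<open>A\<close> the part before it could be cut off, at an inner vertex in
  \<open>B\<close> the part after it.\<close>

lemma path_between_avoiding:
  assumes "(a, b) \<in> (lnk G W)\<^sup>*" "a \<in> W" "W \<subseteq> verts G" "a \<in> A" "b \<in> B"
  shows "\<exists>p. path_between G A B p \<and> path_verts p \<subseteq> W \<and> inner_verts p \<inter> (A \<union> B) = {}"
proof -
  let ?P = "\<lambda>p. path_between G A B p \<and> path_verts p \<subseteq> W"
  obtain p where p: "?P p" "\<And>q. path_len q < path_len p \<Longrightarrow> \<not> ?P q"
  proof -
    obtain q where "?P q" using path_of_rtrancl[OF assms(1-3)] assms(4,5)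
      unfolding path_between_def by auto
    from ex_has_least_nat[of ?P, OF this, of path_len] obtain p
      where "?P p" "\<forall>q. ?P q \<longrightarrow> path_len p \<le> path_len q" by blast
    then show ?thesis by (intro that[of p]) (auto simp: not_less[symmetric])
  qed
  obtain xs es where pe: "p = (xs, es)" by force
  have ip: "is_path G (xs, es)" "hd xs \<in> A" "last xs \<in> B" "set xs \<subseteq> W"
    using p(1) pe by (auto simp: path_between_def path_start_def path_end_def path_verts_def)
  have len: "length xs = Suc (length es)" using ip by (simp add: is_path_def)
  have "inner_verts p \<inter> (A \<union> B) = {}"
  proof (rule ccontr)
    assume "inner_verts p \<inter> (A \<union> B) \<noteq> {}"
    then obtain v where v: "v \<in> set xs" "v \<in> A \<union> B" "v \<noteq> hd xs" "v \<noteq> last xs"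
      using pe by (auto simp: inner_verts_def path_verts_def path_start_def path_end_def)
    then obtain i where i: "i < length xs" "xs ! i \<in> A \<union> B" "xs ! i \<noteq> hd xs" "xs ! i \<noteq> last xs"
      by (metis in_set_conv_nth)
    have "xs \<noteq> []" using len by auto
    with i len have "i \<noteq> 0" "i \<noteq> length es"
      by (metis hd_conv_nth, metis last_conv_nth diff_Suc_1)
    with i(1) len have i0: "0 < i" "i < length es" by auto
    from i(2) show False
    proof
      assume A: "xs ! i \<in> A"
      have "?P (drop i xs, drop i es)" using A is_path_drop[OF ip(1) i(1)] ip i(1)
        by (auto simp: path_between_def path_start_def path_end_def path_verts_def hd_drop_conv_nth
            dest: in_set_dropD)
      then show False using p(2) i0 pe by (auto simp: path_len_def)
    next
      assume B: "xs ! i \<in> B"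
      have "hd (take (Suc i) xs) = hd xs" using \<open>xs \<noteq> []\<close> by (cases xs) auto
      moreover have "last (take (Suc i) xs) = xs ! i" using i by (simp add: take_Suc_conv_app_nth)
      ultimately have "?P (take (Suc i) xs, take i es)" using B is_path_take[OF ip(1) i(1)] ip
        by (auto simp: path_between_def path_start_def path_end_def path_verts_def dest: in_set_takeD)
      then show False using p(2) i0 pe by (auto simp: path_len_def)
    qed
  qed
  with p show ?thesis by blast
qed

section \<open>Distances\<close>

lemma gdist_less_iff_path:
  "gdist G x y < enat k \<longleftrightarrow> (\<exists>p. path_between G {x} {y} p \<and> path_len p < k)"
  by (auto simp: gdist_def Inf_less_iff simp del: split_paired_Ex split_paired_All)

text \<open>The proof uses distances through comparisons with a finite bound. These become
  statements on walks, so symmetry and the triangle inequality come from reversing and concatenating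
  walks.\<close>

lemma gdist_less_iff:
  assumes "x \<in> verts G"
  shows "gdist G x y < enat k \<longleftrightarrow> (\<exists>j<k. (x, y) \<in> lnk G (verts G) ^^ j)"
proof
  assume "gdist G x y < enat k"
  then obtain xs es where p: "is_path G (xs, es)" "hd xs = x" "last xs = y" "length es < k"
    by (auto simp: gdist_less_iff_path path_between_def path_start_def path_end_def path_len_def)
  have len: "length xs = Suc (length es)" using p by (simp add: is_path_def)
  then have "xs ! 0 = x" "xs ! length es = y" using p
    by (metis hd_conv_nth length_0_conv nat.distinct(1))
      (use p len in \<open>metis last_conv_nth diff_Suc_1 length_0_conv nat.distinct(1)\<close>)
  then have "(x, y) \<in> lnk G (set xs) ^^ length es"
    using relpow_of_path[OF p(1), of 0 "length es"] len by simp
  then have "(x, y) \<in> lnk G (verts G) ^^ length es"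
    by (rule lnk_relpow_mono) (use p(1) in \<open>simp add: is_path_def\<close>)
  with p(4) show "\<exists>j<k. (x, y) \<in> lnk G (verts G) ^^ j" by blast
next
  assume "\<exists>j<k. (x, y) \<in> lnk G (verts G) ^^ j"
  then obtain j where "j < k" "(x, y) \<in> lnk G (verts G) ^^ j" by blast
  then show "gdist G x y < enat k"
    using path_of_relpow[OF _ assms order_refl, of y j] unfolding gdist_less_iff_path
    by (meson le_less_trans)
qed

lemma gdist_less_sym:
  assumes "x \<in> verts G" "y \<in> verts G" "gdist G x y < enat k"
  shows "gdist G y x < enat k"
  using assms by (auto simp: gdist_less_iff intro: lnk_relpow_sym)

lemma gdist_less_trans:
  assumes "x \<in> verts G" "y \<in> verts G" "gdist G x y < enat a" "gdist G y z < enat b"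
  shows "gdist G x z < enat (a + b)"
proof -
  obtain i j where "i < a" "(x, y) \<in> lnk G (verts G) ^^ i" "j < b" "(y, z) \<in> lnk G (verts G) ^^ j"
    using assms by (auto simp: gdist_less_iff)
  then have "i + j < a + b" "(x, z) \<in> lnk G (verts G) ^^ (i + j)" by (auto simp: relpow_add)
  then show ?thesis using assms(1) by (auto simp: gdist_less_iff)
qed

lemma gdist_self_less: "x \<in> verts G \<Longrightarrow> 0 < k \<Longrightarrow> gdist G x x < enat k"
  by (auto simp: gdist_less_iff intro: exI[of _ 0])

lemma gdist_less_mono: "gdist G x y < enat a \<Longrightarrow> a \<le> b \<Longrightarrow> gdist G x y < enat b"
  by (meson enat_ord_simps(1) less_le_trans)

text \<open>Each vertex splits a short path into two pieces, both of length below \<open>k\<close>,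
  and so is near both ends.\<close>

lemma gdist_less_linked:
  assumes "gdist G x y < enat k"
  shows "(x, y) \<in> (lnk G {z \<in> verts G. gdist G x z < enat k \<and> gdist G z y < enat k})\<^sup>*"
proof -
  obtain xs es where p: "is_path G (xs, es)" "hd xs = x" "last xs = y" "length es < k"
    using assms by (auto simp: gdist_less_iff_path path_between_def path_start_def path_end_def path_len_def)
  have len: "length xs = Suc (length es)" "set xs \<subseteq> verts G" using p by (simp_all add: is_path_def)
  then have ne: "xs \<noteq> []" by auto
  have nth: "xs ! 0 = x" "xs ! length es = y" using p len ne
    by (simp_all add: hd_conv_nth[symmetric] last_conv_nth)
  have L: "lnk G (set xs) ^^ j \<subseteq> lnk G (verts G) ^^ j" for j
    using lnk_relpow_mono[OF _ len(2)] by auto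
  have "set xs \<subseteq> {z \<in> verts G. gdist G x z < enat k \<and> gdist G z y < enat k}"
  proof
    fix z assume "z \<in> set xs"
    then obtain i where i: "i < length xs" "xs ! i = z" by (auto simp: in_set_conv_nth)
    have "(x, z) \<in> lnk G (set xs) ^^ i"
      using relpow_of_path[OF p(1), of 0 i] i nth by simp
    moreover have "(z, y) \<in> lnk G (set xs) ^^ (length es - i)"
      using relpow_of_path[OF p(1), of i "length es"] i nth len by simp
    moreover have "i < k" "length es - i < k" using i len p(4) by auto
    moreover have "x \<in> verts G" "z \<in> verts G" using \<open>z \<in> set xs\<close> nth len by auto
    ultimately show "z \<in> {z \<in> verts G. gdist G x z < enat k \<and> gdist G z y < enat k}"
      using L by (auto simp: gdist_less_iff)
  qed
  moreover have "(x, y) \<in> (lnk G (set xs))\<^sup>*"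
    using path_verts_linked[OF p(1), of x y] nth len by (auto simp: path_verts_def)
  ultimately show ?thesis by (blast intro: lnk_rtrancl_mono)
qed

lemma far_disjoint_iff:
  "far_disjoint G M A B \<longleftrightarrow> (\<forall>a\<in>A. \<forall>b\<in>B. \<not> gdist G a b < enat M)"
  by (auto simp: far_disjoint_def set_dist_def le_INF_iff not_less)

lemma nbhd_iff: "x \<in> nbhd G M S \<longleftrightarrow> x \<in> verts G \<and> (\<exists>s\<in>S. gdist G x s < enat M)"
  by (auto simp: nbhd_def set_dist_def INF_less_iff)

lemma nbhd_mono: "M \<le> N \<Longrightarrow> nbhd G M S \<subseteq> nbhd G N S"
  using gdist_less_mono unfolding nbhd_iff subset_iff by meson

section \<open>Branch sets\<close>

text \<open>Taking all edges inside \<open>W\<close> makes connectedness a matter of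
  \<open>lnk G W\<close> alone. In return, the paths of the minor must be shown to use no edge
  inside a branch set.\<close>

definition induced :: "('v, 'e) mgraph \<Rightarrow> 'v set \<Rightarrow> ('v, 'e) mgraph" where
  "induced G W = \<lparr>verts = W, edges = {e \<in> edges G. ends G e \<subseteq> W}, ends = ends G\<rparr>"

lemma verts_induced [simp]: "verts (induced G W) = W"
  by (simp add: induced_def)

lemma subgraph_induced:
  assumes "multigraph G" "W \<subseteq> verts G"
  shows "subgraph (induced G W) G"
  using assms by (fastforce simp: subgraph_def multigraph_def induced_def)

lemma connected_induced:
  assumes "W \<noteq> {}" "\<And>x y. x \<in> W \<Longrightarrow> y \<in> W \<Longrightarrow> (x, y) \<in> (lnk G W)\<^sup>*"
  shows "connected_graph (induced G W)"
proof -
  have "lnk (induced G W) W = lnk G W" by (auto simp: lnk_def induced_def)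
  then show ?thesis using assms path_of_rtrancl[of _ _ "induced G W" W]
    unfolding connected_graph_def verts_induced by (metis order_refl)
qed

lemma connected_subgraph_linked:
  assumes "subgraph X G" "connected_graph X" "x \<in> verts X" "y \<in> verts X"
  shows "(x, y) \<in> (lnk G (verts X))\<^sup>*"
proof -
  obtain p where p: "is_path X p" "path_start p = x" "path_end p = y"
    using assms by (fastforce simp: connected_graph_def path_between_def)
  then have "(x, y) \<in> (lnk X (path_verts p))\<^sup>*"
    using path_verts_linked path_ends_mem by metis
  then have "(x, y) \<in> (lnk X (verts X))\<^sup>*"
    using lnk_rtrancl_mono path_verts_subset[OF p(1)] by metis
  moreover have "lnk X (verts X) \<subseteq> lnk G (verts X)"
    using assms(1) by (fastforce simp: lnk_def subgraph_def)
  ultimately show ?thesis using rtrancl_mono by blast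
qed

text \<open>Added to \<open>A\<close> are the components of the graph induced on \<open>U\<close>
  that meet \<open>A\<close>. The set \<open>A\<close> itself may stick out of \<open>U\<close>: the
  given \<open>X\<close> and \<open>Y\<close> can enter the balls.\<close>

definition enlarge :: "('v, 'e) mgraph \<Rightarrow> 'v set \<Rightarrow> 'v set \<Rightarrow> 'v set" where
  "enlarge G U A = A \<union> {v. \<exists>x\<in>A \<inter> U. (x, v) \<in> (lnk G U)\<^sup>*}"

lemma subset_enlarge: "A \<subseteq> enlarge G U A"
  by (auto simp: enlarge_def)

lemma enlarge_subset: "enlarge G U A \<subseteq> A \<union> U"
  by (auto simp: enlarge_def dest: lnk_rtrancl_mem)

lemma enlarge_cases:
  assumes "v \<in> enlarge G U A"
  obtains "v \<in> A" | x where "x \<in> A \<inter> U" "v \<in> U" "(x, v) \<in> (lnk G U)\<^sup>*"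
  using assms by (auto simp: enlarge_def dest: lnk_rtrancl_mem)

text \<open>Every vertex on a walk in \<open>U\<close> that starts in \<open>A\<close> is itself in
  the enlarged set.\<close>

lemma enlarge_linked_within:
  assumes "(x, v) \<in> (lnk G U)\<^sup>*" "x \<in> A" "x \<in> U"
  shows "(x, v) \<in> (lnk G (enlarge G U A))\<^sup>*"
  using assms(1)
proof (induction rule: rtrancl_induct)
  case (step y z)
  then have "(x, z) \<in> (lnk G U)\<^sup>*" by simp
  with step assms have "y \<in> enlarge G U A" "z \<in> enlarge G U A"
    by (auto simp: enlarge_def)
  with step show ?case by (auto simp: lnk_def intro: rtrancl_into_rtrancl)
qed simp

lemma enlarge_linked:
  assumes "\<And>x y. x \<in> A \<Longrightarrow> y \<in> A \<Longrightarrow> (x, y) \<in> (lnk G A)\<^sup>*"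
    and "u \<in> enlarge G U A" "v \<in> enlarge G U A"
  shows "(u, v) \<in> (lnk G (enlarge G U A))\<^sup>*"
proof -
  let ?L = "(lnk G (enlarge G U A))\<^sup>*"
  have *: "\<exists>x\<in>A. (x, v) \<in> ?L" if "v \<in> enlarge G U A" for v
    using that by (rule enlarge_cases) (auto intro: enlarge_linked_within)
  obtain x y where "x \<in> A" "(x, u) \<in> ?L" "y \<in> A" "(y, v) \<in> ?L" using * assms(2,3) by blast
  moreover have "(x, y) \<in> ?L"
    using assms(1) \<open>x \<in> A\<close> \<open>y \<in> A\<close> lnk_rtrancl_mono subset_enlarge by metis
  ultimately show ?thesis by (meson lnk_rtrancl_sym rtrancl_trans)
qed

text \<open>The walk is followed until it first enters \<open>B\<close>, at \<open>v\<close>;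
  \<open>u\<close> is the vertex just before. Since \<open>u\<close> is still outside of
  \<open>B\<close>, it gives control over how deep in \<open>B\<close> the vertex \<open>v\<close>
  can lie.\<close>

lemma first_entry:
  assumes "(x, y) \<in> (lnk G W)\<^sup>*" "x \<in> W - B"
  shows "(x, y) \<in> (lnk G (W - B))\<^sup>* \<or> (\<exists>u v. (x, u) \<in> (lnk G (W - B))\<^sup>* \<and> (u, v) \<in> lnk G W \<and> v \<in> B)"
  using assms(1)
proof (induction rule: rtrancl_induct)
  case (step y z)
  show ?case
  proof (cases "z \<in> B")
    case False
    from step.IH show ?thesis
    proof
      assume *: "(x, y) \<in> (lnk G (W - B))\<^sup>*"
      then have "y \<in> W - B" using lnk_rtrancl_mem assms(2) by metis
      with False step(2) have "(y, z) \<in> lnk G (W - B)" by (auto simp: lnk_def)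
      with * show ?thesis by (meson rtrancl_into_rtrancl)
    qed blast
  qed (use step in blast)
qed simp

text \<open>Walk from \<open>x\<close> towards \<open>h\<close> up to the first vertex
  \<open>v\<close> in the ball of radius \<open>Suc R\<close> around \<open>s\<close>. All earlier
  vertices avoid the balls of radius \<open>Suc R\<close> around \<open>S\<close>, so
  \<open>v\<close>, one step further, still avoids those of radius \<open>R\<close> and is reached
  inside the set by which \<open>A\<close> is enlarged.\<close>

lemma enlarge_meets_ball:
  assumes S: "S \<subseteq> verts G" "s \<in> S" and W: "W \<subseteq> verts G" "W \<inter> nbhd G (Suc R) (S - {s}) = {}"
    and x: "x \<in> A" "x \<in> W" "(x, h) \<in> (lnk G W)\<^sup>*" "gdist G h s < enat (Suc R)"
  shows "\<exists>a \<in> enlarge G (verts G - nbhd G R S) A. a \<in> nbhd G (Suc R) {s}"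
proof (cases "x \<in> nbhd G (Suc R) {s}")
  case True
  then show ?thesis using subset_enlarge[of A G] x(1) by blast
next
  case False
  let ?B = "nbhd G (Suc R) {s}" and ?U = "verts G - nbhd G R S"
  have WB: "W - ?B \<subseteq> verts G - nbhd G (Suc R) S"
    using W by (fastforce simp: nbhd_iff)
  have U: "verts G - nbhd G (Suc R) S \<subseteq> ?U"
    using nbhd_mono[of R "Suc R" G S] by auto
  have "h \<in> W" using x lnk_rtrancl_mem by metis
  then have h: "h \<in> ?B" using x(4) W(1) by (auto simp: nbhd_iff)
  have "(x, h) \<notin> (lnk G (W - ?B))\<^sup>*"
    using lnk_rtrancl_mem[of x h G "W - ?B"] h x(2) False by blast
  then obtain u v where uv: "(x, u) \<in> (lnk G (W - ?B))\<^sup>*" "(u, v) \<in> lnk G W" "v \<in> ?B"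
    using first_entry[OF x(3), of ?B] False x(2) by blast
  have u: "u \<in> W - ?B" using lnk_rtrancl_mem[OF uv(1)] False x(2) by blast
  have v: "v \<in> W" "v \<in> verts G" using uv(2) W(1) by (auto simp: lnk_def)
  \<comment> \<open>If \<open>v\<close> were in a ball of radius \<open>R\<close>, its neighbour
    \<open>u\<close> would be in the ball of radius \<open>Suc R\<close> with the same
    centre.\<close>
  have vU: "v \<in> ?U"
  proof (rule ccontr)
    assume "v \<notin> ?U"
    then obtain t where t: "t \<in> S" "gdist G v t < enat R" using v by (auto simp: nbhd_iff)
    have "u \<in> verts G" using u W by auto
    obtain j where j: "j < R" "(v, t) \<in> lnk G (verts G) ^^ j"
      using t(2) v(2) by (auto simp: gdist_less_iff)
    have "(u, v) \<in> lnk G (verts G)" using uv(2) lnk_mono[OF W(1)] by blast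
    then have "(u, t) \<in> lnk G (verts G) ^^ Suc j" using j(2) by (rule relpow_Suc_I2)
    with j(1) have "gdist G u t < enat (Suc R)"
      unfolding gdist_less_iff[OF \<open>u \<in> verts G\<close>] by (intro exI[of _ "Suc j"]) auto
    then show False using u WB t(1) by (auto simp: nbhd_iff)
  qed
  have "(x, u) \<in> (lnk G ?U)\<^sup>*" using uv(1) WB U by (blast intro: lnk_rtrancl_mono)
  moreover have "(u, v) \<in> lnk G ?U" using uv(2) u vU WB U by (auto simp: lnk_def)
  ultimately have "(x, v) \<in> (lnk G ?U)\<^sup>*" by simp
  moreover have "x \<in> ?U" using x(2) False WB U by blast
  ultimately have "v \<in> enlarge G ?U A" using x(1) by (auto simp: enlarge_def)
  with uv(3) show ?thesis by blast
qed

text \<open>A connection shorter than \<open>K\<close> with one end outside of the \<open>(K + M\<^sub>0)\<close>-balls misses the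
  \<open>M\<^sub>0\<close>-balls.\<close>

lemma enlarge_far:
  assumes S: "S \<subseteq> verts G" and AB: "A \<subseteq> verts G" "B \<subseteq> verts G"
    and far: "far_disjoint G K A B"
    and sep: "\<And>p. path_between G A B p \<Longrightarrow> path_verts p \<inter> nbhd G M S \<noteq> {}"
  shows "far_disjoint G K (enlarge G (verts G - nbhd G (K + M) S) A)
    (enlarge G (verts G - nbhd G (K + M) S) B)"
  unfolding far_disjoint_iff
proof (intro ballI notI)
  let ?U = "verts G - nbhd G (K + M) S"
  fix a b
  assume a: "a \<in> enlarge G ?U A" and b: "b \<in> enlarge G ?U B" and ab: "gdist G a b < enat K"
  let ?Z = "{z \<in> verts G. gdist G a z < enat K \<and> gdist G z b < enat K}"
  let ?V = "verts G - nbhd G M S"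
  have UV: "?U \<subseteq> ?V" using nbhd_mono[of M "K + M" G S] by auto
  have av: "a \<in> verts G" and bv: "b \<in> verts G" using a b AB enlarge_subset[of G ?U A] enlarge_subset[of G ?U B] by auto
  have K: "0 < K"
    using ab by (cases K) (auto simp: zero_enat_def[symmetric])
  \<comment> \<open>Otherwise \<open>a\<close> and \<open>b\<close> belong to the original sets,
    which are at distance at least \<open>K\<close>.\<close>
  have "a \<in> ?U \<or> b \<in> ?U"
  proof (rule enlarge_cases[OF a], rule enlarge_cases[OF b])
    assume "a \<in> A" "b \<in> B"
    then show ?thesis using far ab by (auto simp: far_disjoint_iff)
  qed auto
  \<comment> \<open>A vertex of \<open>?Z\<close> within \<open>M\<close> of some \<open>s\<close>
    would bring both \<open>a\<close> and \<open>b\<close> within \<open>K + M\<close> of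
    \<open>s\<close>, but one of them lies in \<open>?U\<close>.\<close>
  have "?Z \<subseteq> ?V"
  proof
    fix z assume z: "z \<in> ?Z"
    have "\<not> gdist G z s < enat M" if s: "s \<in> S" for s
    proof
      assume zs: "gdist G z s < enat M"
      have "gdist G a s < enat (K + M)" using gdist_less_trans[OF av _ _ zs] z by auto
      moreover have "gdist G b z < enat K" using gdist_less_sym bv z by auto
      then have "gdist G b s < enat (K + M)" using gdist_less_trans[OF bv _ _ zs] z by auto
      ultimately show False using \<open>a \<in> ?U \<or> b \<in> ?U\<close> s by (auto simp: nbhd_iff)
    qed
    with z show "z \<in> ?V" by (auto simp: nbhd_iff)
  qed
  moreover have "a \<in> ?Z" "b \<in> ?Z" using ab av bv K gdist_self_less by auto
  ultimately have aV: "a \<in> ?V" and bV: "b \<in> ?V" by blast+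
  have abV: "(a, b) \<in> (lnk G ?V)\<^sup>*" using gdist_less_linked[OF ab] \<open>?Z \<subseteq> ?V\<close> by (rule lnk_rtrancl_mono)
  \<comment> \<open>Back to the original sets: a point added to \<open>C\<close> is reached from
    \<open>C\<close> inside \<open>?U\<close>, and a point of \<open>C\<close> serves itself, being
    in \<open>?V\<close>.\<close>
  have *: "\<exists>x\<in>C. x \<in> ?V \<and> (x, c) \<in> (lnk G ?V)\<^sup>*" if "c \<in> enlarge G ?U C" "c \<in> ?V" for c C
    using that(1)
  proof (rule enlarge_cases)
    fix x assume "x \<in> C \<inter> ?U" "(x, c) \<in> (lnk G ?U)\<^sup>*"
    then show ?thesis using UV lnk_rtrancl_mono[OF _ UV] by blast
  qed (use that in blast)
  obtain x where x: "x \<in> A" "x \<in> ?V" "(x, a) \<in> (lnk G ?V)\<^sup>*" using *[OF a aV] by blast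
  obtain y where y: "y \<in> B" "(y, b) \<in> (lnk G ?V)\<^sup>*" using *[OF b bV] by blast
  have "(x, y) \<in> (lnk G ?V)\<^sup>*" using x(3) abV lnk_rtrancl_sym[OF y(2)] by (meson rtrancl_trans)
  then obtain p where "path_between G {x} {y} p" "path_verts p \<subseteq> ?V"
    using path_of_rtrancl[OF _ x(2) Diff_subset] by metis
  moreover from this(1) have "path_between G A B p" using x(1) y(1) by (simp add: path_between_def)
  ultimately show False using sep[of p] by blast
qed

section \<open>The dipole\<close>

text \<open>A short path to the centre \<open>s\<close> never leaves the ball, so any two points are
  joined through \<open>s\<close>.\<close>

lemma ball_linked:
  assumes "s \<in> verts G" "a \<in> nbhd G R {s}" "b \<in> nbhd G R {s}"
  shows "(a, b) \<in> (lnk G (nbhd G R {s}))\<^sup>*"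
proof -
  have "(c, s) \<in> (lnk G (nbhd G R {s}))\<^sup>*" if "c \<in> nbhd G R {s}" for c
    using that by (intro lnk_rtrancl_mono[OF gdist_less_linked[of G c s R]]) (auto simp: nbhd_iff)
  from this[OF assms(2)] lnk_rtrancl_sym[OF this[OF assms(3)]] show ?thesis by (rule rtrancl_trans)
qed

text \<open>As \<open>K \<ge> 1\<close>, far sets are disjoint, so most conditions follow from the
  distances. The one on a branch set and a path not ending in it is vacuous, since both vertices of
  the dipole are ends of every edge.\<close>

lemma dipole_fat_minor:
  assumes G: "multigraph G" and K: "K \<ge> 1"
    and AB: "A \<subseteq> verts G" "B \<subseteq> verts G" "A \<noteq> {}" "B \<noteq> {}" "far_disjoint G K A B"
    and A: "\<And>x y. x \<in> A \<Longrightarrow> y \<in> A \<Longrightarrow> (x, y) \<in> (lnk G A)\<^sup>*"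
    and B: "\<And>x y. x \<in> B \<Longrightarrow> y \<in> B \<Longrightarrow> (x, y) \<in> (lnk G B)\<^sup>*"
    and P: "\<And>i. i < k \<Longrightarrow> path_between G A B (P i) \<and> inner_verts (P i) \<inter> (A \<union> B) = {}"
    and PP: "\<And>i j. i < k \<Longrightarrow> j < k \<Longrightarrow> i \<noteq> j \<Longrightarrow> far_disjoint G K (path_verts (P i)) (path_verts (P j))"
  shows "fat_minor_model G K (dipole k) (\<lambda>v. induced G (if v then B else A)) P"
proof -
  have far_disj: "V \<inter> W = {}" if "far_disjoint G K V W" "V \<subseteq> verts G" for V W
    using that K gdist_self_less[of _ G K] by (fastforce simp: far_disjoint_iff)
  have dAB: "A \<inter> B = {}" using far_disj AB by blast
  have farBA: "far_disjoint G K B A"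
    using AB unfolding far_disjoint_iff by (meson gdist_less_sym subsetD)
  have ip: "is_path G (P i)" "path_start (P i) \<in> A" "path_end (P i) \<in> B"
    "path_verts (P i) \<subseteq> A \<union> B \<union> inner_verts (P i)" if "i < k" for i
    using P[OF that] by (auto simp: path_between_def inner_verts_def)
  have len: "path_len (P i) \<ge> 1" if "i < k" for i
  proof (rule ccontr)
    assume "\<not> path_len (P i) \<ge> 1"
    then have "length (fst (P i)) = 1"
      using ip(1)[OF that] by (cases "P i") (simp add: is_path_def path_len_def not_less_eq_eq)
    then have "path_start (P i) = path_end (P i)"
      by (cases "fst (P i)") (auto simp: path_start_def path_end_def)
    then show False using ip[OF that] dAB by auto
  qed
  \<comment> \<open>An edge of the path inside \<open>A\<close> or \<open>B\<close> has no inner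
    vertex as an end, so it joins the start to the end of the path. But these lie in the disjoint
    sets \<open>A\<close> and \<open>B\<close>.\<close>
  have eB: "path_edges (P i) \<inter> edges (induced G C) = {}" if "i < k" "C = A \<or> C = B" for i C
  proof -
    have "False" if e: "e \<in> path_edges (P i)" "ends G e \<subseteq> C" for e
    proof -
      obtain u v where uv: "u \<noteq> v" "ends G e = {u, v}" "u \<in> path_verts (P i)" "v \<in> path_verts (P i)"
        using path_edge_ends[OF ip(1)[OF \<open>i < k\<close>] e(1)] by blast
      then have "u \<notin> inner_verts (P i)" "v \<notin> inner_verts (P i)"
        using P[OF \<open>i < k\<close>] e(2) \<open>C = A \<or> C = B\<close> by auto
      then have "{u, v} = {path_start (P i), path_end (P i)}" using uv by (auto simp: inner_verts_def)
      then show False using ip(2,3)[OF \<open>i < k\<close>] e(2) uv(2) \<open>C = A \<or> C = B\<close> dAB by auto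
    qed
    then show ?thesis by (auto simp: induced_def)
  qed
  have vPP: "path_verts (P i) \<inter> path_verts (P j) = {}" if "i < k" "j < k" "i \<noteq> j" for i j
    using far_disj PP[OF that] path_verts_subset ip(1)[OF that(1)] by metis
  have ePP: "path_edges (P i) \<inter> path_edges (P j) = {}" if ij: "i < k" "j < k" "i \<noteq> j" for i j
  proof -
    have False if e: "e \<in> path_edges (P i)" "e \<in> path_edges (P j)" for e
      using path_edge_ends[OF ip(1)[OF ij(1)] e(1)] path_edge_ends[OF ip(1)[OF ij(2)] e(2)] vPP[OF ij]
      by (auto simp: doubleton_eq_iff)
    then show ?thesis by blast
  qed
  have sub: "subgraph (induced G C) G \<and> connected_graph (induced G C)" if "C = A \<or> C = B" for C
    using that subgraph_induced[OF G] connected_induced AB A B by metis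
  have "minor_model G (dipole k) (\<lambda>v. induced G (if v then B else A)) P"
    unfolding minor_model_def
  proof (intro conjI ballI impI)
    fix e assume "e \<in> edges (dipole k)"
    then have e: "e < k" by (simp add: dipole_def)
    show "1 \<le> path_len (P e)" using len e .
    show "\<exists>u v. ends (dipole k) e = {u, v} \<and> path_between G (verts (induced G (if u then B else A)))
       (verts (induced G (if v then B else A))) (P e)"
      using P[OF e] by (intro exI[of _ False] exI[of _ True]) (auto simp: dipole_def)
    fix w :: bool
    show "inner_verts (P e) \<inter> verts (induced G (if w then B else A)) = {}"
      using P[OF e] by auto
    show "path_edges (P e) \<inter> edges (induced G (if w then B else A)) = {}"
      using eB[OF e] by auto
  next
    fix e f assume "e \<in> edges (dipole k)" "f \<in> edges (dipole k)" "e \<noteq> f"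
    then have ef: "e < k" "f < k" "e \<noteq> f" by (auto simp: dipole_def)
    show "inner_verts (P e) \<inter> inner_verts (P f) = {}"
      using vPP[OF ef] by (auto simp: inner_verts_def)
    show "path_edges (P e) \<inter> path_edges (P f) = {}" using ePP[OF ef] .
  qed (use sub dAB in auto)
  then show ?thesis using AB(5) farBA PP
    unfolding fat_minor_model_def by (auto simp: dipole_def)
qed

text \<open>If \<open>s\<close> and \<open>t\<close> were closer than \<open>r\<close>, the ball of
  radius \<open>M\<^sub>0\<close> around \<open>s\<close> would lie in the ball of radius
  \<open>M\<^sub>0 + r\<close> around \<open>t\<close>. Then \<open>S - {s}\<close> with the larger
  radius would meet everything that \<open>S\<close> meets, although it has at most \<open>n\<close>
  points. In the application \<open>Q\<close> describes the \<open>X\<close>, \<open>Y\<close>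
  paths.\<close>

lemma spread_of_no_small_separator:
  assumes S: "S \<subseteq> verts G" "finite S" "card S \<le> n + 1"
    and sep: "\<And>p. Q p \<Longrightarrow> path_verts p \<inter> nbhd G M\<^sub>0 S \<noteq> {}"
    and nosep: "\<And>T. T \<subseteq> S \<Longrightarrow> card T \<le> n \<Longrightarrow> \<exists>p. Q p \<and> path_verts p \<inter> nbhd G (M\<^sub>0 + r) T = {}"
    and st: "s \<in> S" "t \<in> S" "s \<noteq> t"
  shows "\<not> gdist G s t < enat r"
proof
  assume st_near: "gdist G s t < enat r"
  have "card (S - {s}) \<le> n" using S st by simp
  then obtain p where p: "Q p" "path_verts p \<inter> nbhd G (M\<^sub>0 + r) (S - {s}) = {}"
    using nosep[of "S - {s}"] by blast
  obtain x u where x: "x \<in> path_verts p" "x \<in> verts G" "u \<in> S" "gdist G x u < enat M\<^sub>0"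
    using sep[OF p(1)] by (auto simp: nbhd_iff)
  have "\<exists>v\<in>S - {s}. gdist G x v < enat (M\<^sub>0 + r)"
  proof (cases "u = s")
    case True
    then show ?thesis using gdist_less_trans[OF x(2) _ x(4)] st_near st S(1) by blast
  next
    case False
    then show ?thesis using x gdist_less_mono[OF x(4) le_add1] by blast
  qed
  then have "x \<in> nbhd G (M\<^sub>0 + r) (S - {s})" using x(2) by (simp add: nbhd_iff)
  then show False using p(2) x(1) by blast
qed

theorem theorem4p2:
  fixes G :: "('v, 'e) mgraph" and n :: nat
  assumes "n \<ge> 1"
    and "multigraph G" and "connected_graph G" and "infinite (verts G)" and "unbounded_graph G"
    and "coarsely_bottlenecked G (n + 1)"
    and "\<not> coarsely_bottlenecked G n"
  shows "asymptotic_minor G (dipole (n + 1))"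
  unfolding asymptotic_minor_def
proof (intro allI impI)
  fix K :: nat
  assume K: "1 \<le> K"
  obtain M\<^sub>0 where M\<^sub>0: "fat_bottlenecked G M\<^sub>0 (n + 1)"
    using assms(6) by (auto simp: coarsely_bottlenecked_def)
  \<comment> \<open>The radius for which \<open>enlarge_far\<close> keeps the enlarged sets at
    distance \<open>K\<close>.\<close>
  define R where "R = K + M\<^sub>0"
  \<comment> \<open>Two balls of radius \<open>Suc R\<close> and a gap \<open>K\<close> between
    them: centres at distance at least \<open>r\<close> keep paths inside the balls at distance at
    least \<open>K\<close>. Moreover \<open>M\<^sub>0 + r\<close> is positive, as a fatness has to
    be.\<close>
  define r where "r = Suc R + K + Suc R"
  have "\<not> fat_bottlenecked G (M\<^sub>0 + r) n"
    using assms(7) by (auto simp: coarsely_bottlenecked_def r_def)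
  then obtain X Y where X: "subgraph X G" "connected_graph X" and Y: "subgraph Y G" "connected_graph Y"
    and XY: "far_disjoint G (M\<^sub>0 + r) (verts X) (verts Y)"
    and unsep: "\<not> (\<exists>T. T \<subseteq> verts G - (verts X \<union> verts Y) \<and> finite T \<and> card T \<le> n
      \<and> (\<forall>p. path_between G (verts X) (verts Y) p \<longrightarrow> path_verts p \<inter> nbhd G (M\<^sub>0 + r) T \<noteq> {}))"
    unfolding fat_bottlenecked_def not_all not_imp by (elim exE conjE) rule
  have nosep: "\<exists>p. path_between G (verts X) (verts Y) p \<and> path_verts p \<inter> nbhd G (M\<^sub>0 + r) T = {}"
    if "T \<subseteq> verts G - (verts X \<union> verts Y)" "finite T" "card T \<le> n" for T
    using unsep that by blast
  have far: "far_disjoint G k (verts X) (verts Y)" if "k \<le> M\<^sub>0 + r" for k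
    using XY that unfolding far_disjoint_iff by (meson gdist_less_mono)
  obtain S where S: "S \<subseteq> verts G - (verts X \<union> verts Y)" "finite S" "card S \<le> n + 1"
    and sep: "\<And>p. path_between G (verts X) (verts Y) p \<Longrightarrow> path_verts p \<inter> nbhd G M\<^sub>0 S \<noteq> {}"
  proof -
    have "subgraph X G \<and> connected_graph X \<and> subgraph Y G \<and> connected_graph Y
        \<and> far_disjoint G M\<^sub>0 (verts X) (verts Y)"
      using X Y far[of M\<^sub>0] by simp
    from M\<^sub>0[unfolded fat_bottlenecked_def, THEN spec, THEN spec, THEN mp, OF this] that
    show ?thesis by blast
  qed
  have SG: "S \<subseteq> verts G" using S(1) by auto
  have nosep': "\<exists>p. path_between G (verts X) (verts Y) p \<and> path_verts p \<inter> nbhd G (M\<^sub>0 + r) T = {}"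
    if "T \<subseteq> S" "card T \<le> n" for T
    using nosep[OF _ finite_subset[OF that(1) S(2)] that(2)] that(1) S(1) by auto
  have nbhd_M\<^sub>0: "nbhd G M\<^sub>0 T \<subseteq> nbhd G (M\<^sub>0 + r) T" for T
    by (rule nbhd_mono) simp
  have "card S = n + 1"
  proof (rule ccontr)
    assume "card S \<noteq> n + 1"
    then have "card S \<le> n" using S(3) by simp
    then obtain p where p: "path_between G (verts X) (verts Y) p"
      "path_verts p \<inter> nbhd G (M\<^sub>0 + r) S = {}"
      using nosep'[OF order_refl] by blast
    then show False using sep[OF p(1)] nbhd_M\<^sub>0[of S] by blast
  qed
  then obtain s where s: "bij_betw s {..<n + 1} S"
    using ex_bij_betw_nat_finite[OF S(2)] by (auto simp: lessThan_atLeast0)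
  have spread: "\<not> gdist G u v < enat r" if "u \<in> S" "v \<in> S" "u \<noteq> v" for u v
    using spread_of_no_small_separator[OF SG S(2,3) sep nosep' that] .
  define U where "U = verts G - nbhd G R S"
  define A where "A = enlarge G U (verts X)"
  define B where "B = enlarge G U (verts Y)"
  have XG: "verts X \<subseteq> verts G" and YG: "verts Y \<subseteq> verts G"
    using X Y by (auto simp: subgraph_def)
  have AG: "A \<subseteq> verts G" and BG: "B \<subseteq> verts G"
    using XG YG enlarge_subset[of G U] by (auto simp: A_def B_def U_def)
  have AB: "A \<noteq> {}" "B \<noteq> {}"
    using subset_enlarge[of _ G U] X(2) Y(2) by (fastforce simp: A_def B_def connected_graph_def)+
  have ABfar: "far_disjoint G K A B"
    unfolding A_def B_def U_def R_def
    by (rule enlarge_far[OF SG XG YG far sep]) (auto simp: r_def)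
  have "\<exists>p. path_between G A B p \<and> path_verts p \<subseteq> nbhd G (Suc R) {t} \<and> inner_verts p \<inter> (A \<union> B) = {}"
    if t: "t \<in> S" for t
  proof -
    have "card (S - {t}) \<le> n" using S t by simp
    then obtain p where p: "path_between G (verts X) (verts Y) p"
      "path_verts p \<inter> nbhd G (M\<^sub>0 + r) (S - {t}) = {}"
      using nosep'[of "S - {t}"] by blast
    have ip: "is_path G p" "path_start p \<in> verts X" "path_end p \<in> verts Y"
      using p(1) by (auto simp: path_between_def)
    obtain h where h: "h \<in> path_verts p" "h \<in> nbhd G M\<^sub>0 S" using sep[OF p(1)] by blast
    \<comment> \<open>The path avoids the balls around \<open>S - {t}\<close>, so the point of
      \<open>S\<close> near \<open>h\<close> can only be \<open>t\<close>.\<close>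
    then have "gdist G h t < enat M\<^sub>0"
      using p(2) nbhd_M\<^sub>0[of "S - {t}"] by (fastforce simp: nbhd_iff)
    then have ht: "gdist G h t < enat (Suc R)" by (rule gdist_less_mono) (simp add: R_def)
    have away: "path_verts p \<inter> nbhd G (Suc R) (S - {t}) = {}"
      using p(2) nbhd_mono[of "Suc R" "M\<^sub>0 + r" G "S - {t}"] by (auto simp: r_def)
    \<comment> \<open>This is applied twice, following \<open>p\<close> from its start in
      \<open>X\<close> and from its end in \<open>Y\<close> to \<open>h\<close>.\<close>
    note meets = enlarge_meets_ball[OF SG t path_verts_subset[OF ip(1)] away _ _ _ ht]
    obtain a where a: "a \<in> A" "a \<in> nbhd G (Suc R) {t}"
      using meets[OF ip(2)] path_ends_mem[OF ip(1)] path_verts_linked[OF ip(1)] h(1)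
      unfolding A_def U_def by blast
    obtain b where b: "b \<in> B" "b \<in> nbhd G (Suc R) {t}"
      using meets[OF ip(3)] path_ends_mem[OF ip(1)] path_verts_linked[OF ip(1)] h(1)
      unfolding B_def U_def by blast
    have "nbhd G (Suc R) {t} \<subseteq> verts G" by (auto simp: nbhd_iff)
    \<comment> \<open>The path of the dipole is a new one, found inside the ball; \<open>p\<close>
      served to show that \<open>A\<close> and \<open>B\<close> both meet this ball.\<close>
    then show ?thesis
      using path_between_avoiding[OF ball_linked _ _ a(1) b(1)] a b t SG by blast
  qed
  then obtain P where P: "\<And>t. t \<in> S \<Longrightarrow> path_between G A B (P t)
      \<and> path_verts (P t) \<subseteq> nbhd G (Suc R) {t} \<and> inner_verts (P t) \<inter> (A \<union> B) = {}"
    by metis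
  have sS: "s i \<in> S" if "i < n + 1" for i using s that by (auto simp: bij_betw_def)
  have "far_disjoint G K (path_verts (P (s i))) (path_verts (P (s j)))"
    if ij: "i < n + 1" "j < n + 1" "i \<noteq> j" for i j
    unfolding far_disjoint_iff
  proof (intro ballI notI)
    fix u v assume u: "u \<in> path_verts (P (s i))" and v: "v \<in> path_verts (P (s j))"
      and uv: "gdist G u v < enat K"
    have "s i \<noteq> s j" using s ij by (auto simp: bij_betw_def inj_on_def)
    have G: "u \<in> verts G" "gdist G u (s i) < enat (Suc R)" "v \<in> verts G" "gdist G v (s j) < enat (Suc R)"
      "s i \<in> verts G"
      using P[OF sS[OF ij(1)]] P[OF sS[OF ij(2)]] u v sS[OF ij(1)] SG by (auto simp: nbhd_iff)
    \<comment> \<open>The chain from \<open>s i\<close> over \<open>u\<close> and \<open>v\<close>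
      to \<open>s j\<close> is shorter than \<open>r\<close>, against the spread of
      \<open>S\<close>.\<close>
    have "gdist G (s i) u < enat (Suc R)" using gdist_less_sym[OF G(1,5,2)] .
    then have "gdist G (s i) v < enat (Suc R + K)" using gdist_less_trans[OF G(5,1) _ uv] by blast
    then have "gdist G (s i) (s j) < enat r" unfolding r_def using gdist_less_trans[OF G(5,3) _ G(4)] by blast
    then show False using spread[OF sS[OF ij(1)] sS[OF ij(2)] \<open>s i \<noteq> s j\<close>] by simp
  qed
  then have "fat_minor_model G K (dipole (n + 1)) (\<lambda>v. induced G (if v then B else A)) (\<lambda>i. P (s i))"
  proof (intro dipole_fat_minor[OF assms(2) K AG BG AB ABfar])
    show "(x, y) \<in> (lnk G A)\<^sup>*" if "x \<in> A" "y \<in> A" for x y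
      using enlarge_linked[OF connected_subgraph_linked[OF X]] that unfolding A_def by blast
    show "(x, y) \<in> (lnk G B)\<^sup>*" if "x \<in> B" "y \<in> B" for x y
      using enlarge_linked[OF connected_subgraph_linked[OF Y]] that unfolding B_def by blast
    show "path_between G A B (P (s i)) \<and> inner_verts (P (s i)) \<inter> (A \<union> B) = {}" if "i < n + 1" for i
      using P[OF sS[OF that]] by blast
  qed
  then show "\<exists>B P. fat_minor_model G K (dipole (n + 1)) B P" by blast
qed

end
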